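(* Let $\mathfrak g=\mathfrak g(a,v,A)$ be a $2n$-dimensional Hermitian almost abelian Lie algebra with Hermitian structure $(J,g)$ and with $\det A\neq0$. Let $\alpha\in\mathfrak g^*$ be a non-zero closed $1$-form and put $\lambda_{2n}=\alpha(e_{2n})$. Then $(J,g)$ is LCSKT with closed $1$-form $\alpha$ (that is, $dH=\alpha\wedge H$) if and only if $[A,A^t]=[A,J_1]=0$ and each eigenvalue of $A$ has real part equal to $0$ or $-\frac12(a+\lambda_{2n})$.
   Context: A real Lie algebra is almost abelian if it contains a codimension-one abelian ideal $\mathfrak n$. Given a Hermitian structure $(J,g)$ on such a $2n$-dimensional $\mathfrak g$ ($J$ an endomorphism with $J^2=-\mathrm{Id}$ and vanishing Nijenhuis tensor, $g$ an inner product with $g(J\cdot,J\cdot)=g$), there is an orthonormal basis $\{e_1,\dots,e_{2n}\}$ with $\mathfrak n=\mathrm{span}\langle e_1,\dots,e_{2n-1}\rangle$, $\mathfrak n_1:=\mathfrak n\cap J\mathfrak n=\mathrm{span}\langle e_2,\dots,e_{2n-1}\rangle$, $Je_i=e_{2n+1-i}$ for $i=1,\dots,n$ (so $Je_1=e_{2n}$, $J\mathfrak n_1\subset\mathfrak n_1$). Put $J_1=J|_{\mathfrak n_1}$. The Lie brackets are $$[e_{2n},e_1]=ae_1+v,\qquad [e_{2n},X]=AX\ \ (X\in\mathfrak n_1),$$ with $a\in\mathbb R$, $v\in\mathfrak n_1$, $A\in\mathfrak{gl}(\mathfrak n_1)$, $[A,J_1]=0$; the Hermitian Lie algebra is denoted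 $\mathfrak g(a,v,A)$. $A^t$ is the transpose with respect to $g|_{\mathfrak n_1}$; eigenvalues of $A$ are taken in $\mathbb C$. The fundamental form is $\Omega(X,Y)=g(JX,Y)$, the Bismut torsion $3$-form is $H=d^c\Omega$, i.e. $H(X,Y,Z)=-d\Omega(JX,JY,JZ)$ ($d$ the Chevalley–Eilenberg differential). $(J,g)$ is LCSKT if there is a non-zero closed $1$-form $\alpha$ on $\mathfrak g$ with $dH=\alpha\wedge H$. *)

theory Defs
  imports "HOL-Analysis.Analysis" "Jordan_Normal_Form.Char_Poly"
begin

text \<open>
  The Lie algebra is the underlying space of a type of class \<open>euclidean_space\<close>, with an
  explicit bracket \<open>br\<close>; the Hermitian metric \<open>g\<close> is the inner product of the type.
\<close>

definition lie_bracket :: "('a::real_vector \<Rightarrow> 'a \<Rightarrow> 'a) \<Rightarrow> bool" where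
  "lie_bracket br \<longleftrightarrow> bilinear br \<and> (\<forall>x. br x x = 0) \<and>
     (\<forall>x y z. br x (br y z) + br y (br z x) + br z (br x y) = 0)"

definition codim_one_abelian_ideal ::
    "('a::euclidean_space \<Rightarrow> 'a \<Rightarrow> 'a) \<Rightarrow> 'a set \<Rightarrow> bool" where
  "codim_one_abelian_ideal br N \<longleftrightarrow> subspace N \<and> dim N + 1 = DIM('a) \<and>
     (\<forall>x. \<forall>y\<in>N. br x y \<in> N) \<and> (\<forall>x\<in>N. \<forall>y\<in>N. br x y = 0)"

definition nijenhuis :: "('a::real_vector \<Rightarrow> 'a \<Rightarrow> 'a) \<Rightarrow> ('a \<Rightarrow> 'a) \<Rightarrow> 'a \<Rightarrow> 'a \<Rightarrow> 'a" where
  "nijenhuis br J x y = br (J x) (J y) - J (br (J x) y) - J (br x (J y)) - br x y"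

definition hermitian_structure ::
    "('a::real_inner \<Rightarrow> 'a \<Rightarrow> 'a) \<Rightarrow> ('a \<Rightarrow> 'a) \<Rightarrow> bool" where
  "hermitian_structure br J \<longleftrightarrow> linear J \<and> (\<forall>x. J (J x) = - x) \<and>
     (\<forall>x y. nijenhuis br J x y = 0) \<and> (\<forall>x y. inner (J x) (J y) = inner x y)"

definition n1 :: "'a set \<Rightarrow> ('a \<Rightarrow> 'a) \<Rightarrow> 'a set" where
  "n1 N J = N \<inter> J ` N"

text \<open>The basis vectors are \<open>e 1, \<dots>, e (2 * n)\<close>; other values of \<open>e\<close> are irrelevant.
  For \<open>n = 1\<close> the space \<open>n1 N J\<close> is zero.\<close>

definition adapted_basis ::
    "('a::euclidean_space \<Rightarrow> 'a) \<Rightarrow> 'a set \<Rightarrow> nat \<Rightarrow> (nat \<Rightarrow> 'a) \<Rightarrow> bool" where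
  "adapted_basis J N n e \<longleftrightarrow> DIM('a) = 2 * n \<and>
     (\<forall>i\<in>{1..2*n}. \<forall>j\<in>{1..2*n}. inner (e i) (e j) = (if i = j then 1 else 0)) \<and>
     N = span (e ` {1..2*n-1}) \<and>
     n1 N J = span (e ` {2..2*n-1}) \<and>
     (\<forall>i\<in>{1..n}. J (e i) = e (2*n + 1 - i))"

definition endomorphism_on :: "'a::real_vector set \<Rightarrow> ('a \<Rightarrow> 'a) \<Rightarrow> bool" where
  "endomorphism_on S f \<longleftrightarrow> (\<forall>x\<in>S. f x \<in> S) \<and>
     (\<forall>x\<in>S. \<forall>y\<in>S. f (x + y) = f x + f y) \<and> (\<forall>c. \<forall>x\<in>S. f (c *\<^sub>R x) = c *\<^sub>R f x)"

definition commutator :: "('a::ab_group_add \<Rightarrow> 'a) \<Rightarrow> ('a \<Rightarrow> 'a) \<Rightarrow> 'a \<Rightarrow> 'a" where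
  "commutator f h x = f (h x) - h (f x)"

text \<open>\<open>hermitian_almost_abelian br J N n e a v A\<close>: with respect to the ideal \<open>N\<close> and the
  basis \<open>e\<close>, the Hermitian Lie algebra is \<open>g(a,v,A)\<close>. Only the values of \<open>A\<close> on \<open>n1 N J\<close>
  matter. As \<open>n1 N J\<close> is \<open>J\<close>-invariant, \<open>J\<close> itself stands for its restriction there.\<close>

definition hermitian_almost_abelian ::
    "('a::euclidean_space \<Rightarrow> 'a \<Rightarrow> 'a) \<Rightarrow> ('a \<Rightarrow> 'a) \<Rightarrow> 'a set \<Rightarrow> nat \<Rightarrow> (nat \<Rightarrow> 'a)
      \<Rightarrow> real \<Rightarrow> 'a \<Rightarrow> ('a \<Rightarrow> 'a) \<Rightarrow> bool" where
  "hermitian_almost_abelian br J N n e a v A \<longleftrightarrow>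
     lie_bracket br \<and> codim_one_abelian_ideal br N \<and> hermitian_structure br J \<and>
     adapted_basis J N n e \<and>
     v \<in> n1 N J \<and> endomorphism_on (n1 N J) A \<and>
     (\<forall>x\<in>n1 N J. commutator A J x = 0) \<and>
     br (e (2*n)) (e 1) = a *\<^sub>R e 1 + v \<and>
     (\<forall>x\<in>n1 N J. br (e (2*n)) x = A x)"

text \<open>The transpose of an endomorphism of the subspace \<open>S\<close> with respect to the restricted inner
  product (cf. \<open>adjoint\<close>); it is determined only on \<open>S\<close>.\<close>

definition transpose_on :: "'a::real_inner set \<Rightarrow> ('a \<Rightarrow> 'a) \<Rightarrow> 'a \<Rightarrow> 'a" where
  "transpose_on S f = (SOME f'. (\<forall>y\<in>S. f' y \<in> S) \<and>
     (\<forall>x\<in>S. \<forall>y\<in>S. inner (f x) y = inner x (f' y)))"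

text \<open>The matrix of \<open>A\<close> in the orthonormal basis \<open>e 2, \<dots>, e (2 * n - 1)\<close> of \<open>n1 N J\<close>;
  matrix indices start at 0.\<close>

definition matrix_n1 ::
    "nat \<Rightarrow> (nat \<Rightarrow> 'a::real_inner) \<Rightarrow> ('a \<Rightarrow> 'a) \<Rightarrow> real Matrix.mat" where
  "matrix_n1 n e A =
     Matrix.mat (2*n - 2) (2*n - 2) (\<lambda>(i, j). inner (e (i + 2)) (A (e (j + 2))))"

text \<open>Forms are curried functions. The Chevalley--Eilenberg differential of a k-form is
  \<open>d\<omega>(x\<^sub>0,\<dots>,x\<^sub>k) = \<Sum>\<^sub>i\<^sub><\<^sub>j (-1)\<^sup>i\<^sup>+\<^sup>j \<omega>([x\<^sub>i,x\<^sub>j],x\<^sub>0,\<dots>)\<close> with \<open>x\<^sub>i, x\<^sub>j\<close> omitted, written out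
  for k = 1, 2, 3. The wedge product carries no factorial factor:
  \<open>(\<alpha> \<and> \<eta>)(x\<^sub>0,\<dots>,x\<^sub>k) = \<Sum>\<^sub>i (-1)\<^sup>i \<alpha>(x\<^sub>i) \<eta>(x\<^sub>0,\<dots>)\<close> with \<open>x\<^sub>i\<close> omitted.\<close>

definition d1 :: "('a \<Rightarrow> 'a \<Rightarrow> 'a) \<Rightarrow> ('a \<Rightarrow> real) \<Rightarrow> 'a \<Rightarrow> 'a \<Rightarrow> real" where
  "d1 br \<alpha> x y = - \<alpha> (br x y)"

definition d2 :: "('a \<Rightarrow> 'a \<Rightarrow> 'a) \<Rightarrow> ('a \<Rightarrow> 'a \<Rightarrow> real) \<Rightarrow> 'a \<Rightarrow> 'a \<Rightarrow> 'a \<Rightarrow> real" where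
  "d2 br \<omega> x y z = - \<omega> (br x y) z + \<omega> (br x z) y - \<omega> (br y z) x"

definition d3 ::
    "('a \<Rightarrow> 'a \<Rightarrow> 'a) \<Rightarrow> ('a \<Rightarrow> 'a \<Rightarrow> 'a \<Rightarrow> real) \<Rightarrow> 'a \<Rightarrow> 'a \<Rightarrow> 'a \<Rightarrow> 'a \<Rightarrow> real" where
  "d3 br \<eta> x y z w =
     - \<eta> (br x y) z w + \<eta> (br x z) y w - \<eta> (br x w) y z
     - \<eta> (br y z) x w + \<eta> (br y w) x z - \<eta> (br z w) x y"

definition wedge13 ::
    "('a \<Rightarrow> real) \<Rightarrow> ('a \<Rightarrow> 'a \<Rightarrow> 'a \<Rightarrow> real) \<Rightarrow> 'a \<Rightarrow> 'a \<Rightarrow> 'a \<Rightarrow> 'a \<Rightarrow> real" where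
  "wedge13 \<alpha> \<eta> x y z w = \<alpha> x * \<eta> y z w - \<alpha> y * \<eta> x z w + \<alpha> z * \<eta> x y w - \<alpha> w * \<eta> x y z"

definition nonzero_closed_form :: "('a::real_vector \<Rightarrow> 'a \<Rightarrow> 'a) \<Rightarrow> ('a \<Rightarrow> real) \<Rightarrow> bool" where
  "nonzero_closed_form br \<alpha> \<longleftrightarrow> linear \<alpha> \<and> \<alpha> \<noteq> (\<lambda>_. 0) \<and> (\<forall>x y. d1 br \<alpha> x y = 0)"

definition fundamental_form :: "('a::real_inner \<Rightarrow> 'a) \<Rightarrow> 'a \<Rightarrow> 'a \<Rightarrow> real" where
  "fundamental_form J x y = inner (J x) y"

definition bismut_torsion ::
    "('a::real_inner \<Rightarrow> 'a \<Rightarrow> 'a) \<Rightarrow> ('a \<Rightarrow> 'a) \<Rightarrow> 'a \<Rightarrow> 'a \<Rightarrow> 'a \<Rightarrow> real" where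
  "bismut_torsion br J x y z = - d2 br (fundamental_form J) (J x) (J y) (J z)"

definition lcskt_with ::
    "('a::real_inner \<Rightarrow> 'a \<Rightarrow> 'a) \<Rightarrow> ('a \<Rightarrow> 'a) \<Rightarrow> ('a \<Rightarrow> real) \<Rightarrow> bool" where
  "lcskt_with br J \<alpha> \<longleftrightarrow> nonzero_closed_form br \<alpha> \<and>
     (\<forall>x y z w. d3 br (bismut_torsion br J) x y z w = wedge13 \<alpha> (bismut_torsion br J) x y z w)"

end

theory Submission
  imports Defs "Jordan_Normal_Form.Schur_Decomposition"
begin

text \<open>
  Let \<open>V\<close> be the subspace \<open>n1 N J\<close>, let \<open>L\<close> be \<open>A\<close> extended by zero to the whole space, put
  \<open>S = L + L\<^sup>T\<close>, and write \<open>e\<^sup>1\<close>, \<open>e\<^sup>2\<^sup>n\<close> for the first and last vectors of the dual basis.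

  The geometry reduces the claim to one operator equation. The torsion is
  \<open>H = e\<^sup>1 \<and> \<beta> - e\<^sup>1 \<and> e\<^sup>2\<^sup>n \<and> v\<close> with \<open>\<beta>(y, z) = g(S J y, z)\<close> (lemma \<open>torsion\<close>). As \<open>A\<close> is
  invertible, a closed \<open>\<alpha>\<close> vanishes on \<open>V = A V = [e\<^sub>2\<^sub>n, V]\<close>, so it is a combination of \<open>e\<^sup>1\<close> and
  \<open>e\<^sup>2\<^sup>n\<close> (lemma \<open>closed_form\<close>). Every term of \<open>dH\<close> and of \<open>\<alpha> \<and> H\<close> then contains
  \<open>e\<^sup>1 \<and> e\<^sup>2\<^sup>n\<close>, the part of \<open>H\<close> with \<open>v\<close> contributes nothing, and with
  \<open>c = a + \<alpha>(e\<^sub>2\<^sub>n)\<close> the equation \<open>dH = \<alpha> \<and> H\<close> becomes the Lyapunov-type equation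
  \<open>L\<^sup>T S + S L + c S = 0\<close> on \<open>V\<close> (lemma \<open>d_torsion_eq_wedge_iff\<close>).

  The rest is linear algebra about a complex square matrix \<open>M\<close>, its adjoint \<open>M\<^sup>*\<close> and
  \<open>S = M + M\<^sup>*\<close> (theorem \<open>lyapunov_iff_normal_eigenvalues\<close>). Substituting \<open>M\<^sup>* = S - M\<close>, the equation
  says \<open>T = M S - S M\<close>, where \<open>T = S\<^sup>2 + c S\<close>. The matrix \<open>T\<close> is Hermitian and commutes with \<open>S\<close>,
  hence \<open>tr T\<^sup>2 = tr (T M S) - tr (T S M) = 0\<close> and \<open>T = 0\<close>. Thus \<open>M\<close> commutes with \<open>S\<close>, which
  means that \<open>M\<close> is normal; and an eigenvector of a normal \<open>M\<close> with eigenvalue \<open>\<mu>\<close> is an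
  eigenvector of \<open>T\<close> with eigenvalue \<open>2 Re \<mu> (2 Re \<mu> + c)\<close>, which must vanish. Conversely, if \<open>M\<close>
  is normal and its eigenvalues satisfy this condition, \<open>T\<close> kills all eigenvectors of \<open>M\<close>, and
  an induction along a triangularisation of \<open>M\<close> gives \<open>T = 0\<close> (lemma
  \<open>schur_induction_annihilated\<close>). As \<open>M\<close> commutes with \<open>S\<close>, this is the equation again.
\<close>

section \<open>The Lyapunov-type equation for a complex matrix\<close>

lemma mat_adjoint_index:
  fixes A :: "complex Matrix.mat"
  assumes "i < dim_col A" "j < dim_row A"
  shows "mat_adjoint A $$ (i, j) = cnj (A $$ (j, i))"
  using assms unfolding mat_adjoint_def by (simp add: mat_of_rows_def)

lemma mat_adjoint_dims [simp]:
  "dim_row (mat_adjoint A) = dim_col A" "dim_col (mat_adjoint A) = dim_row A"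
  unfolding mat_adjoint_def by (auto simp: mat_of_rows_def)

lemma mat_adjoint_carrier [simp]:
  "A \<in> carrier_mat k m \<Longrightarrow> mat_adjoint A \<in> carrier_mat m k"
  by auto

lemma mat_adjoint_adjoint [simp]: "mat_adjoint (mat_adjoint A) = (A :: complex Matrix.mat)"
  by (intro eq_matI) (auto simp: mat_adjoint_index)

lemma mat_adjoint_add:
  fixes A B :: "complex Matrix.mat"
  assumes "A \<in> carrier_mat k m" "B \<in> carrier_mat k m"
  shows "mat_adjoint (A + B) = mat_adjoint A + mat_adjoint B"
  using assms by (intro eq_matI) (auto simp: mat_adjoint_index)

lemma mat_adjoint_smult:
  fixes A :: "complex Matrix.mat"
  shows "mat_adjoint (c \<cdot>\<^sub>m A) = cnj c \<cdot>\<^sub>m mat_adjoint A"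
  by (intro eq_matI) (auto simp: mat_adjoint_index)

lemma mat_adjoint_mult:
  fixes A B :: "complex Matrix.mat"
  assumes "A \<in> carrier_mat k m" "B \<in> carrier_mat m l"
  shows "mat_adjoint (A * B) = mat_adjoint B * mat_adjoint A"
  using assms
  by (intro eq_matI) (auto simp: mat_adjoint_index scalar_prod_def mult.commute)

lemma cscalar_prod_adjoint:
  fixes A :: "complex Matrix.mat"
  assumes A: "A \<in> carrier_mat k m" and x: "x \<in> carrier_vec m" and y: "y \<in> carrier_vec k"
  shows "(A *\<^sub>v x) \<bullet>c y = x \<bullet>c (mat_adjoint A *\<^sub>v y)"
proof -
  have "(A *\<^sub>v x) \<bullet>c y = (\<Sum>i<k. \<Sum>j<m. A $$ (i, j) * vec_index x j * cnj (vec_index y i))"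
    using A x y by (simp add: scalar_prod_def lessThan_atLeast0 sum_distrib_right)
  also have "\<dots> = (\<Sum>j<m. \<Sum>i<k. A $$ (i, j) * vec_index x j * cnj (vec_index y i))"
    by (rule sum.swap)
  also have "\<dots> = x \<bullet>c (mat_adjoint A *\<^sub>v y)"
    using A x y
    by (auto simp: scalar_prod_def lessThan_atLeast0 sum_distrib_left mat_adjoint_index
        intro!: sum.cong)
  finally show ?thesis .
qed

definition mat_trace :: "complex Matrix.mat \<Rightarrow> complex" where
  "mat_trace A = (\<Sum>i<dim_row A. A $$ (i, i))"

lemma mat_trace_minus:
  assumes "A \<in> carrier_mat m m" "B \<in> carrier_mat m m"
  shows "mat_trace (A - B) = mat_trace A - mat_trace B"
  using assms by (simp add: mat_trace_def sum_subtractf)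

lemma mat_trace_commute:
  assumes "A \<in> carrier_mat m k" "B \<in> carrier_mat k m"
  shows "mat_trace (A * B) = mat_trace (B * A)"
proof -
  have "mat_trace (A * B) = (\<Sum>i<m. \<Sum>j<k. A $$ (i, j) * B $$ (j, i))"
    using assms by (simp add: mat_trace_def scalar_prod_def lessThan_atLeast0)
  also have "\<dots> = (\<Sum>j<k. \<Sum>i<m. A $$ (i, j) * B $$ (j, i))"
    by (rule sum.swap)
  also have "\<dots> = mat_trace (B * A)"
    using assms by (simp add: mat_trace_def scalar_prod_def lessThan_atLeast0 mult.commute)
  finally show ?thesis .
qed

text \<open>
  For Hermitian \<open>T\<close> the trace of \<open>T\<^sup>2\<close> is the sum of the squared moduli of the entries.
\<close>

lemma hermitian_trace_square_eq_0:
  assumes T: "T \<in> carrier_mat m m" and herm: "mat_adjoint T = T"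
    and tr: "mat_trace (T * T) = 0"
  shows "T = 0\<^sub>m m m"
proof -
  have sym: "T $$ (j, i) = cnj (T $$ (i, j))" if "i < m" "j < m" for i j
    using mat_adjoint_index[of j T i] herm T that by simp
  have "mat_trace (T * T) = (\<Sum>i<m. \<Sum>j<m. T $$ (i, j) * T $$ (j, i))"
    using T by (simp add: mat_trace_def scalar_prod_def lessThan_atLeast0)
  also have "\<dots> = (\<Sum>i<m. \<Sum>j<m. complex_of_real ((cmod (T $$ (i, j)))\<^sup>2))"
    by (intro sum.cong refl) (metis complex_norm_square lessThan_iff sym)
  also have "\<dots> = complex_of_real (\<Sum>i<m. \<Sum>j<m. (cmod (T $$ (i, j)))\<^sup>2)"
    by simp
  finally have "(\<Sum>i<m. \<Sum>j<m. (cmod (T $$ (i, j)))\<^sup>2) = 0"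
    using tr by (metis of_real_eq_0_iff)
  then have "\<forall>i<m. \<forall>j<m. T $$ (i, j) = 0"
    by (simp add: sum_nonneg_eq_0_iff sum_nonneg)
  with T show ?thesis by (intro eq_matI) auto
qed

text \<open>
  The vector \<open>z = M\<^sup>* w - cnj \<mu> w\<close> satisfies \<open>M z = \<mu> z\<close> by normality. Therefore
  \<open>\<langle>z, M\<^sup>* w\<rangle> = \<langle>M z, w\<rangle> = \<mu> \<langle>z, w\<rangle>\<close>, that is, \<open>\<langle>z, z\<rangle> = 0\<close>.
\<close>

lemma normal_adjoint_eigenvector:
  fixes M :: "complex Matrix.mat"
  assumes M: "M \<in> carrier_mat m m" and normal: "M * mat_adjoint M = mat_adjoint M * M"
    and w: "w \<in> carrier_vec m" and ev: "M *\<^sub>v w = \<mu> \<cdot>\<^sub>v w"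
  shows "mat_adjoint M *\<^sub>v w = cnj \<mu> \<cdot>\<^sub>v w"
proof -
  let ?N = "mat_adjoint M"
  define z where "z = ?N *\<^sub>v w - cnj \<mu> \<cdot>\<^sub>v w"
  note N = mat_adjoint_carrier[OF M]
  have z: "z \<in> carrier_vec m" using N w by (simp add: z_def)
  have Nw: "?N *\<^sub>v w \<in> carrier_vec m" using N w by simp
  have "M *\<^sub>v (?N *\<^sub>v w) = ?N *\<^sub>v (M *\<^sub>v w)"
    using assoc_mult_mat_vec[OF M N w] assoc_mult_mat_vec[OF N M w] normal by simp
  then have "M *\<^sub>v z = \<mu> \<cdot>\<^sub>v (?N *\<^sub>v w) - cnj \<mu> \<cdot>\<^sub>v (\<mu> \<cdot>\<^sub>v w)"
    unfolding z_def using M N w Nw ev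
    by (simp add: mult_minus_distrib_mat_vec[OF M Nw] mult_mat_vec[OF M] mult_mat_vec[OF N])
  also have "\<dots> = \<mu> \<cdot>\<^sub>v z"
    unfolding z_def using M w
    by (intro eq_vecI) (auto simp: right_diff_distrib simp del: index_mult_mat_vec)
  finally have Mz: "M *\<^sub>v z = \<mu> \<cdot>\<^sub>v z" .
  have "z \<bullet>c (u - k \<cdot>\<^sub>v w) = z \<bullet>c u - cnj k * (z \<bullet>c w)" if "u \<in> carrier_vec m" for u k
    using z w that
    by (simp add: scalar_prod_def sum_distrib_left algebra_simps flip: sum_subtractf)
  from this[OF Nw, of "cnj \<mu>"]
  have "z \<bullet>c z = z \<bullet>c (?N *\<^sub>v w) - \<mu> * (z \<bullet>c w)"
    by (simp flip: z_def)
  also have "z \<bullet>c (?N *\<^sub>v w) = \<mu> * (z \<bullet>c w)"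
    unfolding cscalar_prod_adjoint[OF M z w, symmetric] Mz using z w by simp
  finally have "z = 0\<^sub>v m" using z by simp
  show ?thesis
  proof (intro eq_vecI)
    fix i assume i: "i < dim_vec (cnj \<mu> \<cdot>\<^sub>v w)"
    have "vec_index z i = 0" using \<open>z = 0\<^sub>v m\<close> i w by simp
    then show "vec_index (?N *\<^sub>v w) i = vec_index (cnj \<mu> \<cdot>\<^sub>v w) i"
      using i w Nw by (simp add: z_def del: index_mult_mat_vec)
  qed (use w M in simp)
qed

text \<open>
  By normality \<open>w\<close> is also an eigenvector of \<open>M + M\<^sup>*\<close>, with eigenvalue \<open>\<mu> + cnj \<mu> = 2 Re \<mu>\<close>.
\<close>

lemma sym_part_eigenvector:
  fixes M :: "complex Matrix.mat" and c :: real
  defines "S \<equiv> M + mat_adjoint M"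
  assumes M: "M \<in> carrier_mat m m" and normal: "M * mat_adjoint M = mat_adjoint M * M"
    and w: "w \<in> carrier_vec m" and ev: "M *\<^sub>v w = \<mu> \<cdot>\<^sub>v w"
  shows "(S * S + complex_of_real c \<cdot>\<^sub>m S) *\<^sub>v w
    = complex_of_real (2 * Re \<mu> * (2 * Re \<mu> + c)) \<cdot>\<^sub>v w"
proof -
  define s where "s = complex_of_real (2 * Re \<mu>)"
  note N = mat_adjoint_carrier[OF M]
  have S: "S \<in> carrier_mat m m" using M N by (simp add: S_def)
  have s: "\<mu> + cnj \<mu> = s" by (simp add: s_def complex_add_cnj)
  have Sw: "S *\<^sub>v w = s \<cdot>\<^sub>v w"
    unfolding S_def add_mult_distrib_mat_vec[OF M N w] ev
      normal_adjoint_eigenvector[OF M normal w ev] s[symmetric]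
    by (simp add: add_smult_distrib_vec)
  have cS: "(complex_of_real c \<cdot>\<^sub>m S) *\<^sub>v w = complex_of_real c \<cdot>\<^sub>v (S *\<^sub>v w)"
    using S w by (intro eq_vecI) (auto simp: scalar_prod_def sum_distrib_left mult.assoc)
  have "(S * S + complex_of_real c \<cdot>\<^sub>m S) *\<^sub>v w
      = S *\<^sub>v (S *\<^sub>v w) + complex_of_real c \<cdot>\<^sub>v (S *\<^sub>v w)"
    using S w by (simp add: add_mult_distrib_mat_vec[of _ m m] assoc_mult_mat_vec[of _ m m _ m] cS)
  also have "\<dots> = (s * (s + complex_of_real c)) \<cdot>\<^sub>v w"
    using S w
    by (simp add: Sw mult_mat_vec[OF S w] smult_smult_assoc distrib_left mult.commute
        add_smult_distrib_vec)
  finally show ?thesis by (simp add: s_def)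
qed

lemma sym_part_polynomial_hermitian:
  fixes M :: "complex Matrix.mat" and c :: real
  defines "S \<equiv> M + mat_adjoint M"
  assumes M: "M \<in> carrier_mat m m"
  shows "mat_adjoint (S * S + complex_of_real c \<cdot>\<^sub>m S) = S * S + complex_of_real c \<cdot>\<^sub>m S"
proof -
  note N = mat_adjoint_carrier[OF M]
  have S: "S \<in> carrier_mat m m" using M N by (simp add: S_def)
  have "mat_adjoint S = S"
    unfolding S_def by (simp add: mat_adjoint_add[OF M N] comm_add_mat[OF N M])
  then show ?thesis
    using S by (simp add: mat_adjoint_add[of _ m m] mat_adjoint_smult mat_adjoint_mult[of _ m m _ m])
qed

text \<open>
  The trace argument: \<open>T = S\<^sup>2 + c S\<close> equals the commutator of \<open>M\<close> and \<open>S\<close>, and it commutes with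
  \<open>S\<close>, so \<open>tr (T T) = tr (T M S) - tr (T S M) = 0\<close> by cyclicity of the trace.
\<close>

lemma lyapunov_imp_sym_part_annihilated:
  fixes M :: "complex Matrix.mat" and c :: real
  defines "S \<equiv> M + mat_adjoint M"
  assumes M: "M \<in> carrier_mat m m"
    and lyap: "mat_adjoint M * S + S * M + complex_of_real c \<cdot>\<^sub>m S = 0\<^sub>m m m"
  shows "S * S + complex_of_real c \<cdot>\<^sub>m S = 0\<^sub>m m m" "M * S = S * M"
proof -
  let ?N = "mat_adjoint M"
  note N = mat_adjoint_carrier[OF M]
  define T where "T = S * S + complex_of_real c \<cdot>\<^sub>m S"
  have S: "S \<in> carrier_mat m m" using M N by (simp add: S_def)
  have T: "T \<in> carrier_mat m m" using S by (simp add: T_def)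
  have SS: "S * S = M * S + ?N * S"
    using add_mult_distrib_mat[OF M N S] by (simp add: S_def)
  have T_comm: "T = M * S - S * M"
  proof (intro eq_matI)
    fix i j assume "i < dim_row (M * S - S * M)" "j < dim_col (M * S - S * M)"
    then have ij: "i < m" "j < m" using M S by auto
    from arg_cong[OF lyap, of "\<lambda>X. X $$ (i, j)"]
    have "(?N * S) $$ (i, j) + (S * M) $$ (i, j) + c * S $$ (i, j) = 0"
      using M N S ij by (simp del: index_mult_mat(1))
    then show "T $$ (i, j) = (M * S - S * M) $$ (i, j)"
      unfolding T_def SS using M N S ij
      by (simp add: algebra_simps eq_neg_iff_add_eq_0 del: index_mult_mat(1))
  qed (use M S T in auto)
  have herm_T: "mat_adjoint T = T"
    unfolding T_def S_def by (rule sym_part_polynomial_hermitian[OF M])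
  have ST: "S * T = T * S"
    unfolding T_def using S
    by (simp add: add_mult_distrib_mat[of _ m m] mult_add_distrib_mat[of _ m m _ m]
        mult_smult_assoc_mat[of _ m m _ m] mult_smult_distrib[of _ m m _ m] assoc_mult_mat[of _ m m _ m _ m])
  have MS: "M * S \<in> carrier_mat m m" and SM: "S * M \<in> carrier_mat m m"
    and TM: "T * M \<in> carrier_mat m m"
    using M S T by auto
  have "mat_trace (T * T) = mat_trace (T * (M * S)) - mat_trace (T * (S * M))"
    using mult_minus_distrib_mat[OF T MS SM] T MS SM
    by (simp add: mat_trace_minus[of _ m] flip: T_comm)
  also have "mat_trace (T * (M * S)) = mat_trace (S * (T * M))"
    using mat_trace_commute[OF TM S] assoc_mult_mat[OF T M S] by simp
  also have "S * (T * M) = T * (S * M)"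
    using assoc_mult_mat[OF S T M] assoc_mult_mat[OF T S M] ST by simp
  finally have T0: "T = 0\<^sub>m m m"
    using hermitian_trace_square_eq_0[OF T herm_T] by simp
  then show "S * S + complex_of_real c \<cdot>\<^sub>m S = 0\<^sub>m m m" by (simp add: T_def)
  show "M * S = S * M"
  proof (intro eq_matI)
    fix i j assume "i < dim_row (S * M)" "j < dim_col (S * M)"
    then have ij: "i < m" "j < m" using M S by auto
    have "(M * S - S * M) $$ (i, j) = 0" using T0 T_comm ij by simp
    then show "(M * S) $$ (i, j) = (S * M) $$ (i, j)"
      using M S ij by (simp del: index_mult_mat(1))
  qed (use M S in auto)
qed

lemma commutes_sym_part_iff_normal:
  fixes M :: "complex Matrix.mat"
  assumes M: "M \<in> carrier_mat m m"
  shows "M * (M + mat_adjoint M) = (M + mat_adjoint M) * M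
    \<longleftrightarrow> M * mat_adjoint M = mat_adjoint M * M"
proof -
  let ?N = "mat_adjoint M"
  note N = mat_adjoint_carrier[OF M]
  have MN: "M * ?N \<in> carrier_mat m m" and NM: "?N * M \<in> carrier_mat m m"
    and MM: "M * M \<in> carrier_mat m m" using M N by auto
  have "M * M + M * ?N = M * M + ?N * M \<longleftrightarrow> M * ?N = ?N * M"
  proof
    assume eq: "M * M + M * ?N = M * M + ?N * M"
    show "M * ?N = ?N * M"
    proof (intro eq_matI)
      fix i j assume "i < dim_row (?N * M)" "j < dim_col (?N * M)"
      then have ij: "i < m" "j < m" using M by auto
      from arg_cong[OF eq, of "\<lambda>X. X $$ (i, j)"]
      show "(M * ?N) $$ (i, j) = (?N * M) $$ (i, j)"
        using MM MN NM M ij by (simp del: index_mult_mat(1))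
    qed (use M in auto)
  qed simp
  then show ?thesis
    using mult_add_distrib_mat[OF M M N] add_mult_distrib_mat[OF M N M] by simp
qed

text \<open>
  A matrix \<open>T\<close> that commutes with \<open>M\<close> and kills the eigenvectors of \<open>M\<close> is zero as soon as \<open>T\<^sup>2\<close>
  and \<open>T\<close> have the same kernel. Triangularise \<open>M P = P B\<close> and argue along the columns \<open>p\<^sub>j\<close> of \<open>P\<close>.
  If \<open>T\<close> kills the earlier columns, then \<open>M T p\<^sub>j = T M p\<^sub>j = B\<^sub>j\<^sub>j T p\<^sub>j\<close>, so \<open>T p\<^sub>j\<close> is zero or an
  eigenvector of \<open>M\<close>; either way \<open>T T p\<^sub>j = 0\<close>, hence \<open>T p\<^sub>j = 0\<close>.
\<close>

lemma schur_induction_annihilated: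
  fixes M T :: "complex Matrix.mat"
  assumes M: "M \<in> carrier_mat m m" and T: "T \<in> carrier_mat m m"
    and comm: "M * T = T * M"
    and semisimple: "\<And>x. x \<in> carrier_vec m \<Longrightarrow> T *\<^sub>v (T *\<^sub>v x) = 0\<^sub>v m \<Longrightarrow> T *\<^sub>v x = 0\<^sub>v m"
    and eig: "\<And>\<mu> y. eigenvector M y \<mu> \<Longrightarrow> T *\<^sub>v y = 0\<^sub>v m"
  shows "T = 0\<^sub>m m m"
proof -
  from char_poly_factorized[OF M] obtain as
    where "char_poly M = (\<Prod>a\<leftarrow>as. [:- a, 1:])" by blast
  from schur_decomposition_exists[OF M this] obtain B P Q
    where upper: "upper_triangular B" and sim: "similar_mat_wit M B P Q"
    by (auto simp: similar_mat_def)
  note wit = similar_mat_witD2[OF M sim]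
  have B: "B \<in> carrier_mat m m" and P: "P \<in> carrier_mat m m" and Q: "Q \<in> carrier_mat m m"
    and PQ: "P * Q = 1\<^sub>m m" and QP: "Q * P = 1\<^sub>m m" and MPBQ: "M = P * B * Q"
    using wit by auto
  define G where "G = T * P"
  have G: "G \<in> carrier_mat m m" using T P by (simp add: G_def)
  have "M * P = P * B"
    unfolding MPBQ using P B Q QP by (simp add: assoc_mult_mat[of _ m m _ m _ m])
  then have MG: "M * G = G * B"
    unfolding G_def using assoc_mult_mat[OF M T P] assoc_mult_mat[OF T M P]
      assoc_mult_mat[OF T P B] comm by simp
  have col_G: "Matrix.col G j = T *\<^sub>v Matrix.col P j" if "j < m" for j
    unfolding G_def using col_mult2[OF T P that] .
  have "Matrix.col G j = 0\<^sub>v m" if "j < m" for j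
    using that
  proof (induction j rule: less_induct)
    case (less j)
    have G0: "G $$ (r, i) = 0" if "i < j" "r < m" for i r
    proof -
      have "vec_index (Matrix.col G i) r = 0" using less that by simp
      then show ?thesis using G less.prems that by simp
    qed
    have B0: "B $$ (i, j) = 0" if "j < i" "i < m" for i
      using upper_triangularD[OF upper that(1)] that B by simp
    have eq: "M *\<^sub>v Matrix.col G j = B $$ (j, j) \<cdot>\<^sub>v Matrix.col G j"
    proof (intro eq_vecI)
      fix r assume "r < dim_vec (B $$ (j, j) \<cdot>\<^sub>v Matrix.col G j)"
      then have r: "r < m" using G by simp
      have "vec_index (M *\<^sub>v Matrix.col G j) r = (M * G) $$ (r, j)"
        using M G r less.prems by simp
      also have "\<dots> = (\<Sum>i<m. G $$ (r, i) * B $$ (i, j))"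
        unfolding MG using G B r less.prems by (simp add: scalar_prod_def lessThan_atLeast0)
      also have "\<dots> = (\<Sum>i\<in>{j}. G $$ (r, i) * B $$ (i, j))"
        using less.prems r by (intro sum.mono_neutral_right) (auto, metis B0 G0 linorder_neqE_nat)
      finally show "vec_index (M *\<^sub>v Matrix.col G j) r
          = vec_index (B $$ (j, j) \<cdot>\<^sub>v Matrix.col G j) r"
        using G r less.prems by simp
    qed (use M G in simp)
    have "T *\<^sub>v Matrix.col G j = 0\<^sub>v m"
    proof (cases "Matrix.col G j = 0\<^sub>v m")
      case True
      then show ?thesis using T by (auto simp: scalar_prod_def)
    next
      case False
      then have "eigenvector M (Matrix.col G j) (B $$ (j, j))"
        using eq M G less.prems by (auto simp: eigenvector_def)
      then show ?thesis by (rule eig)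
    qed
    then show ?case
      using semisimple[of "Matrix.col P j"] P less.prems by (simp add: col_G)
  qed
  then have "G = 0\<^sub>m m m"
    using G by (intro mat_col_eqI) auto
  then have "T * P * Q = 0\<^sub>m m m" using Q by (simp add: G_def)
  then show ?thesis using assoc_mult_mat[OF T P Q] PQ T by simp
qed

text \<open>
  Everything is read off from \<open>T = S\<^sup>2 + c S\<close>: when \<open>M\<close> commutes with \<open>S\<close>, the left-hand side of the
  equation equals \<open>T\<close>.
\<close>

theorem lyapunov_iff_normal_eigenvalues:
  fixes M :: "complex Matrix.mat" and c :: real
  assumes M: "M \<in> carrier_mat m m"
  shows "mat_adjoint M * (M + mat_adjoint M) + (M + mat_adjoint M) * M
      + complex_of_real c \<cdot>\<^sub>m (M + mat_adjoint M) = 0\<^sub>m m m \<longleftrightarrow>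
    M * mat_adjoint M = mat_adjoint M * M \<and>
    (\<forall>\<mu>. eigenvalue M \<mu> \<longrightarrow> Re \<mu> = 0 \<or> Re \<mu> = - (1/2) * c)"
    (is "?lyap \<longleftrightarrow> ?normal \<and> ?spec")
proof -
  let ?N = "mat_adjoint M"
  define S where "S = M + ?N"
  define T where "T = S * S + complex_of_real c \<cdot>\<^sub>m S"
  note N = mat_adjoint_carrier[OF M]
  have S: "S \<in> carrier_mat m m" using M N by (simp add: S_def)
  have T: "T \<in> carrier_mat m m" using S by (simp add: T_def)
  have eig: "T *\<^sub>v w = complex_of_real (2 * Re \<mu> * (2 * Re \<mu> + c)) \<cdot>\<^sub>v w"
    if ?normal "eigenvector M w \<mu>" for w \<mu>
    using sym_part_eigenvector[OF M that(1), of w \<mu> c] that(2) M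
    by (simp add: T_def S_def eigenvector_def)
  show ?thesis
  proof
    assume ?lyap
    note annihilated = lyapunov_imp_sym_part_annihilated[OF M this]
    have normal: ?normal
      using annihilated(2) commutes_sym_part_iff_normal[OF M] by blast
    have T0: "T = 0\<^sub>m m m" using annihilated(1) by (simp add: T_def S_def)
    have ?spec
    proof (intro allI impI)
      fix \<mu> assume "eigenvalue M \<mu>"
      then obtain w where w: "eigenvector M w \<mu>" by (auto simp: eigenvalue_def)
      then have wc: "w \<in> carrier_vec m" and w0: "w \<noteq> 0\<^sub>v m" using M by (auto simp: eigenvector_def)
      obtain i where i: "i < m" "vec_index w i \<noteq> 0"
        using w0 wc by (metis eq_vecI carrier_vecD index_zero_vec)
      have "complex_of_real (2 * Re \<mu> * (2 * Re \<mu> + c)) * vec_index w i = vec_index (T *\<^sub>v w) i"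
        unfolding eig[OF normal w] using wc i by simp
      also have "\<dots> = 0" using T0 wc i by (simp add: scalar_prod_def)
      finally have "2 * Re \<mu> * (2 * Re \<mu> + c) = 0"
        using i by (simp only: mult_eq_0_iff of_real_eq_0_iff) simp
      then show "Re \<mu> = 0 \<or> Re \<mu> = - (1/2) * c" by auto
    qed
    with normal show "?normal \<and> ?spec" ..
  next
    assume "?normal \<and> ?spec"
    then have normal: ?normal and spec: ?spec by auto
    have MS: "M * S = S * M"
      using commutes_sym_part_iff_normal[OF M] normal by (simp add: S_def)
    have herm_T: "mat_adjoint T = T"
      unfolding T_def S_def by (rule sym_part_polynomial_hermitian[OF M])
    have MT: "M * T = T * M"
    proof -
      have "M * (S * S) = S * S * M"
        using MS assoc_mult_mat[OF M S S] assoc_mult_mat[OF S M S] assoc_mult_mat[OF S S M] by simp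
      then show ?thesis
        unfolding T_def using M S MS
        by (simp add: add_mult_distrib_mat[of _ m m] mult_add_distrib_mat[of _ m m _ m]
          mult_smult_assoc_mat[of _ m m _ m] mult_smult_distrib[of _ m m _ m])
    qed
    have "T = 0\<^sub>m m m"
    proof (rule schur_induction_annihilated[OF M T MT])
      fix x :: "complex Matrix.vec"
      assume x: "x \<in> carrier_vec m" and TTx: "T *\<^sub>v (T *\<^sub>v x) = 0\<^sub>v m"
      have Tx: "T *\<^sub>v x \<in> carrier_vec m" using T x by simp
      have "(T *\<^sub>v x) \<bullet>c (T *\<^sub>v x) = 0"
        using cscalar_prod_adjoint[OF T x Tx] x by (simp add: herm_T TTx)
      then show "T *\<^sub>v x = 0\<^sub>v m" using Tx by simp
    next
      fix \<mu> y assume y: "eigenvector M y \<mu>"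
      then have "Re \<mu> = 0 \<or> Re \<mu> = - (1/2) * c"
        using spec by (auto simp: eigenvalue_def)
      then have zero: "2 * Re \<mu> * (2 * Re \<mu> + c) = 0" by auto
      have "y \<in> carrier_vec m" using y M by (simp add: eigenvector_def)
      then show "T *\<^sub>v y = 0\<^sub>v m"
        unfolding eig[OF normal y] zero by auto
    qed
    moreover have "?N * S + S * M = S * S"
      using add_mult_distrib_mat[OF M N S] MS M N S
      by (simp add: S_def[symmetric] comm_add_mat[of "S * M" m m "?N * S"])
    ultimately show ?lyap by (simp add: T_def flip: S_def)
  qed
qed

corollary lyapunov_iff_normal_eigenvalues_real:
  fixes M :: "real Matrix.mat" and c :: real
  assumes M: "M \<in> carrier_mat m m"
  shows "transpose_mat M * (M + transpose_mat M) + (M + transpose_mat M) * M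
      + c \<cdot>\<^sub>m (M + transpose_mat M) = 0\<^sub>m m m \<longleftrightarrow>
    M * transpose_mat M = transpose_mat M * M \<and>
    (\<forall>\<mu>. eigenvalue (map_mat complex_of_real M) \<mu> \<longrightarrow> Re \<mu> = 0 \<or> Re \<mu> = - (1/2) * c)"
proof -
  let ?c = "map_mat complex_of_real"
  let ?Mt = "transpose_mat M"
  have Mt: "?Mt \<in> carrier_mat m m" using M by simp
  have S: "M + ?Mt \<in> carrier_mat m m" using M by simp
  have prods: "?Mt * (M + ?Mt) \<in> carrier_mat m m" "(M + ?Mt) * M \<in> carrier_mat m m"
    using M by auto
  have inj: "?c X = ?c Y \<longleftrightarrow> X = Y" for X Y
    by (auto simp: mat_eq_iff)
  have adj: "mat_adjoint (?c M) = ?c ?Mt"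
    using M by (intro eq_matI) (auto simp: mat_adjoint_index)
  have add: "?c (X + Y) = ?c X + ?c Y" if "X \<in> carrier_mat m m" "Y \<in> carrier_mat m m" for X Y
    using that by (intro eq_matI) auto
  have mult: "?c (X * Y) = ?c X * ?c Y" if "X \<in> carrier_mat m m" "Y \<in> carrier_mat m m" for X Y
    using that by (intro eq_matI) (auto simp: scalar_prod_def)
  have smult: "?c (k \<cdot>\<^sub>m X) = complex_of_real k \<cdot>\<^sub>m ?c X" for k X
    by (intro eq_matI) auto
  have zero: "?c (0\<^sub>m m m) = 0\<^sub>m m m"
    by (intro eq_matI) auto
  have "mat_adjoint (?c M) * (?c M + mat_adjoint (?c M)) + (?c M + mat_adjoint (?c M)) * ?c M
      + complex_of_real c \<cdot>\<^sub>m (?c M + mat_adjoint (?c M))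
      = ?c (?Mt * (M + ?Mt) + (M + ?Mt) * M + c \<cdot>\<^sub>m (M + ?Mt))"
    using M Mt S prods by (simp add: adj add mult smult)
  moreover have "?c M * mat_adjoint (?c M) = ?c (M * ?Mt)"
    "mat_adjoint (?c M) * ?c M = ?c (?Mt * M)"
    using M Mt by (simp_all add: adj mult)
  ultimately show ?thesis
    using lyapunov_iff_normal_eigenvalues[of "?c M" m c] M
    by (simp add: inj flip: zero)
qed

section \<open>Structure of a Hermitian almost abelian Lie algebra\<close>

locale hermitian_almost_abelian_algebra =
  fixes br :: "'a::euclidean_space \<Rightarrow> 'a \<Rightarrow> 'a" and J A :: "'a \<Rightarrow> 'a"
    and N :: "'a set" and n :: nat and e :: "nat \<Rightarrow> 'a" and a :: real and v :: 'a
  assumes haa: "hermitian_almost_abelian br J N n e a v A"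
begin

(* Keeps the basis vectors e 1 and e (k + 2) from being rewritten to successor form. *)
declare One_nat_def [simp del] add_2_eq_Suc' [simp del]

definition p :: "'a \<Rightarrow> real" where "p x = inner (e 1) x"
definition q :: "'a \<Rightarrow> real" where "q x = inner (e (2 * n)) x"
definition proj :: "'a \<Rightarrow> 'a" where "proj x = x - p x *\<^sub>R e 1 - q x *\<^sub>R e (2 * n)"

text \<open>
  \<open>A\<close> extended by zero to the whole space. Only the values of \<open>A\<close> on \<open>n1 N J\<close> are prescribed, while
  \<open>L\<close> is globally linear, commutes with \<open>J\<close> and has an \<open>adjoint\<close>.
\<close>

definition L :: "'a \<Rightarrow> 'a" where "L x = A (proj x)"

lemma lie: "lie_bracket br" and ideal: "codim_one_abelian_ideal br N"
  and herm: "hermitian_structure br J" and basis: "adapted_basis J N n e"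
  and v_in: "v \<in> n1 N J" and endo: "endomorphism_on (n1 N J) A"
  and comm_AJ: "x \<in> n1 N J \<Longrightarrow> A (J x) = J (A x)"
  and br_e1: "br (e (2 * n)) (e 1) = a *\<^sub>R e 1 + v"
  and br_n1: "x \<in> n1 N J \<Longrightarrow> br (e (2 * n)) x = A x"
  using haa by (auto simp: hermitian_almost_abelian_def commutator_def)

lemma n_pos: "n \<ge> 1"
  using basis DIM_positive[where 'a='a] by (simp add: adapted_basis_def)

lemma orthonormal:
  "i \<in> {1..2*n} \<Longrightarrow> j \<in> {1..2*n} \<Longrightarrow> inner (e i) (e j) = (if i = j then 1 else 0)"
  using basis by (simp add: adapted_basis_def)

lemma n1_span: "n1 N J = Real_Vector_Spaces.span (e ` {2..2*n-1})"
  and N_span: "N = Real_Vector_Spaces.span (e ` {1..2*n-1})"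
  and J_e1: "J (e 1) = e (2 * n)"
  using basis n_pos by (auto simp: adapted_basis_def)

text \<open>
  Orthonormal vectors are independent, and there are as many of them as the dimension.
\<close>

lemma span_basis: "Real_Vector_Spaces.span (e ` {1..2*n}) = UNIV"
proof -
  have inj: "inj_on e {1..2*n}"
    by (rule inj_onI) (metis orthonormal zero_neq_one)
  have "pairwise real_inner_class.orthogonal (e ` {1..2*n})"
    by (auto simp: pairwise_def real_inner_class.orthogonal_def orthonormal)
  moreover have "0 \<notin> e ` {1..2*n}"
    using orthonormal by force
  ultimately have "independent (e ` {1..2*n})"
    by (rule pairwise_orthogonal_independent)
  then have "UNIV \<subseteq> Real_Vector_Spaces.span (e ` {1..2*n})"
    using basis by (intro card_ge_dim_independent) (auto simp: card_image[OF inj] adapted_basis_def)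
  then show ?thesis by auto
qed

lemma linear_J: "linear J" and JJ: "J (J x) = - x" and J_iso: "inner (J x) (J y) = inner x y"
  using herm by (auto simp: hermitian_structure_def)

lemma J_skew: "inner (J x) y = - inner x (J y)"
  using J_iso[of x "J y"] by (simp add: JJ)

lemma J_e2n: "J (e (2 * n)) = - e 1"
  using JJ[of "e 1"] by (simp add: J_e1)

lemma subspace_n1: "Real_Vector_Spaces.subspace (n1 N J)"
  by (simp add: n1_span)

lemma n1_coords: "x \<in> n1 N J \<Longrightarrow> p x = 0" "x \<in> n1 N J \<Longrightarrow> q x = 0"
proof -
  have *: "inner u x = 0" if "x \<in> n1 N J" "\<And>i. i \<in> {2..2*n-1} \<Longrightarrow> inner u (e i) = 0" for u x
    using orthogonal_to_span[of x "e ` {2..2*n-1}" u] that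
    by (force simp: n1_span real_inner_class.orthogonal_def)
  show "x \<in> n1 N J \<Longrightarrow> p x = 0"
    unfolding p_def by (rule *) (use n_pos in \<open>auto simp: orthonormal\<close>)
  show "x \<in> n1 N J \<Longrightarrow> q x = 0"
    unfolding q_def by (rule *) (use n_pos in \<open>auto simp: orthonormal\<close>)
qed

lemma basis_coords: "p (e 1) = 1" "p (e (2 * n)) = 0" "q (e 1) = 0" "q (e (2 * n)) = 1"
  using n_pos by (auto simp: p_def q_def orthonormal)

lemma linear_p: "linear p" and linear_q: "linear q"
  unfolding p_def[abs_def] q_def[abs_def]
  by (auto intro!: linearI simp: inner_add_right)

lemma linear_proj: "linear proj"
  unfolding proj_def[abs_def]
  by (auto intro!: linearI simp: linear_add[OF linear_p] linear_add[OF linear_q]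
      linear_cmul[OF linear_p] linear_cmul[OF linear_q] algebra_simps)

lemma proj_n1: "x \<in> n1 N J \<Longrightarrow> proj x = x"
  by (simp add: proj_def n1_coords)

lemma proj_in_n1: "proj x \<in> n1 N J"
proof -
  have "x \<in> Real_Vector_Spaces.span (e ` {1..2*n})" by (simp add: span_basis)
  then show ?thesis
  proof (rule span_induct)
    show "Real_Vector_Spaces.subspace {x. proj x \<in> n1 N J}"
      by (rule linear_subspace_linear_preimage[OF linear_proj subspace_n1])
    fix x assume "x \<in> e ` {1..2*n}"
    then obtain i where i: "i \<in> {1..2*n}" "x = e i" by auto
    then consider "i = 1" | "i = 2 * n" | "i \<in> {2..2*n-1}" by force
    then show "proj x \<in> n1 N J"
    proof cases
      case 3
      then have "x \<in> n1 N J" using i by (auto simp: n1_span span_base)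
      then show ?thesis by (simp add: proj_n1)
    qed (use i subspace_0[OF subspace_n1] in \<open>simp_all add: proj_def basis_coords\<close>)
  qed
qed

lemma decompose: "x = p x *\<^sub>R e 1 + q x *\<^sub>R e (2 * n) + proj x"
  by (simp add: proj_def)

lemma n1_expand:
  assumes "x \<in> n1 N J"
  shows "x = (\<Sum>k<2*n-2. inner (e (k + 2)) x *\<^sub>R e (k + 2))"
proof -
  let ?f = "\<lambda>x. (\<Sum>k<2*n-2. inner (e (k + 2)) x *\<^sub>R e (k + 2))"
  have lin: "linear (\<lambda>x. x - ?f x)"
    by (auto intro!: linearI simp: inner_add_right algebra_simps sum.distrib scaleR_sum_right)
  have "x \<in> Real_Vector_Spaces.span (e ` {2..2*n-1})" using assms by (simp add: n1_span)
  then have "x - ?f x = 0"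
  proof (rule linear_eq_0_on_span[OF lin, rotated])
    fix x assume "x \<in> e ` {2..2*n-1}"
    then obtain i where "i \<in> {2..2*n-1}" "x = e i" by auto
    then obtain j where j: "j < 2 * n - 2" "x = e (j + 2)"
      by (intro that[of "i - 2"]) auto
    have "?f x = (\<Sum>k<2*n-2. if k = j then e (k + 2) else 0)"
      using j by (intro sum.cong refl) (auto simp: orthonormal)
    also have "\<dots> = x" using j by simp
    finally show "x - ?f x = 0" by simp
  qed
  then show ?thesis by simp
qed

lemma A_n1: "x \<in> n1 N J \<Longrightarrow> A x \<in> n1 N J"
  using endo by (auto simp: endomorphism_on_def)

lemma L_n1: "x \<in> n1 N J \<Longrightarrow> L x = A x"
  by (simp add: L_def proj_n1)

lemma L_in_n1: "L x \<in> n1 N J"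
  by (simp add: L_def A_n1 proj_in_n1)

lemma linear_L: "linear L"
proof (rule linearI)
  show "L (x + y) = L x + L y" for x y
    using endo proj_in_n1 by (simp add: L_def endomorphism_on_def linear_add[OF linear_proj])
  show "L (c *\<^sub>R x) = c *\<^sub>R L x" for c x
    using endo proj_in_n1 by (simp add: L_def endomorphism_on_def linear_cmul[OF linear_proj])
qed

lemma L_basis: "L (e 1) = 0" "L (e (2 * n)) = 0"
proof -
  have "proj (e 1) = 0" "proj (e (2 * n)) = 0" by (simp_all add: proj_def basis_coords)
  moreover have "L 0 = 0" by (rule linear_0[OF linear_L])
  moreover have "proj 0 = 0" by (rule linear_0[OF linear_proj])
  ultimately show "L (e 1) = 0" "L (e (2 * n)) = 0" by (simp_all add: L_def)
qed

lemma L_coords: "p (L x) = 0" "q (L x) = 0"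
  by (simp_all add: n1_coords L_in_n1)

lemma J_coords: "p (J x) = - q x" "q (J x) = p x"
  using J_skew[of "e 1" x] J_skew[of "e (2 * n)" x]
  by (simp_all add: p_def q_def J_e1 J_e2n)

lemma proj_J: "proj (J x) = J (proj x)"
  by (simp add: proj_def J_coords linear_diff[OF linear_J] linear_cmul[OF linear_J] J_e1 J_e2n)

lemma L_J: "L (J x) = J (L x)"
  by (simp add: L_def proj_J comm_AJ proj_in_n1)

lemma bilinear_br: "bilinear br" and br_self: "br x x = 0"
  using lie by (auto simp: lie_bracket_def)

lemma br_skew: "br y x = - br x y"
proof -
  have "br x (x + y) + br y (x + y) = 0"
    using br_self[of "x + y"] by (simp only: bilinear_ladd[OF bilinear_br])
  then have "br y x + br x y = 0"
    by (simp add: bilinear_radd[OF bilinear_br] br_self add.commute)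
  then show ?thesis by (simp add: eq_neg_iff_add_eq_0)
qed

lemma br_N: "x \<in> N \<Longrightarrow> y \<in> N \<Longrightarrow> br x y = 0"
  using ideal by (auto simp: codim_one_abelian_ideal_def)

text \<open>
  Both arguments split into a multiple of \<open>e (2 * n)\<close> and a part in the abelian ideal \<open>N\<close>, so only
  brackets with \<open>e (2 * n)\<close> survive.
\<close>

lemma bracket:
  "br x y = (q x * p y - p x * q y) *\<^sub>R (a *\<^sub>R e 1 + v) + q x *\<^sub>R L y - q y *\<^sub>R L x"
proof -
  define x' where "x' = p x *\<^sub>R e 1 + proj x"
  define y' where "y' = p y *\<^sub>R e 1 + proj y"
  have x: "x = q x *\<^sub>R e (2 * n) + x'" and y: "y = q y *\<^sub>R e (2 * n) + y'"
    by (simp_all add: x'_def y'_def proj_def)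
  have e1: "e 1 \<in> N" using n_pos by (auto simp: N_span intro!: span_base)
  have "n1 N J \<subseteq> N" by (auto simp: n1_def)
  then have N: "x' \<in> N" "y' \<in> N"
    using e1 proj_in_n1 unfolding x'_def y'_def N_span
    by (auto intro!: span_add span_scale)
  have E: "br (e (2 * n)) (c *\<^sub>R e 1 + proj z) = c *\<^sub>R (a *\<^sub>R e 1 + v) + L z" for c z
    by (simp add: bilinear_radd[OF bilinear_br] bilinear_rmul[OF bilinear_br] br_e1 br_n1
        proj_in_n1 L_def)
  have "br x y = q x *\<^sub>R br (e (2 * n)) y' - q y *\<^sub>R br (e (2 * n)) x'"
    by (subst x, subst y)
      (simp add: bilinear_radd[OF bilinear_br] bilinear_ladd[OF bilinear_br]
        bilinear_rmul[OF bilinear_br] bilinear_lmul[OF bilinear_br] br_self br_N N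
        br_skew[of x' "e (2 * n)"])
  then show ?thesis
    unfolding x'_def y'_def E by (simp add: algebra_simps)
qed

section \<open>The torsion form and its differential\<close>

text \<open>
  The 2-form with \<open>bismut_torsion = e\<^sup>1 \<and> \<beta> - e\<^sup>1 \<and> e\<^sup>2\<^sup>n \<and> v\<close>, as lemma \<open>torsion\<close> shows.
\<close>

definition \<beta> :: "'a \<Rightarrow> 'a \<Rightarrow> real" where
  "\<beta> x y = inner (L (J x)) y - inner (L (J y)) x"

lemma \<beta>_linear:
  "\<beta> (x + y) z = \<beta> x z + \<beta> y z" "\<beta> (x - y) z = \<beta> x z - \<beta> y z" "\<beta> (c *\<^sub>R x) z = c * \<beta> x z"
  by (simp_all add: \<beta>_def linear_add[OF linear_J] linear_add[OF linear_L] linear_diff[OF linear_J]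
      linear_diff[OF linear_L] linear_cmul[OF linear_J] linear_cmul[OF linear_L]
      inner_add_left inner_add_right inner_diff_left inner_diff_right algebra_simps)

lemma \<beta>_e1: "\<beta> (e 1) y = 0"
  using L_coords(1)[of "J y"]
  by (simp add: \<beta>_def J_e1 L_basis p_def inner_commute)

lemma \<beta>_skew: "\<beta> y x = - \<beta> x y"
  by (simp add: \<beta>_def)

lemma torsion:
  "bismut_torsion br J x y z = p x * \<beta> y z - p y * \<beta> x z + p z * \<beta> x y
    + (q x * p y - p x * q y) * inner v z - (q x * p z - p x * q z) * inner v y
    + (q y * p z - p y * q z) * inner v x"
  unfolding bismut_torsion_def d2_def fundamental_form_def bracket J_coords
  by (simp add: \<beta>_def JJ p_def linear_add[OF linear_J] linear_diff[OF linear_J] linear_cmul[OF linear_J]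
      J_iso J_skew inner_add_left inner_diff_left algebra_simps)

text \<open>
  This shape of \<open>H([x, y], z, w)\<close> turns the identity for \<open>dH\<close> into a polynomial identity in the
  coordinates and in the values of \<open>\<beta>\<close> and of the inner product with \<open>v\<close>.
\<close>

lemma torsion_bracket:
  "bismut_torsion br J (br x y) z w =
    (q x * p y - p x * q y) * (a * \<beta> z w - p z * \<beta> v w + p w * \<beta> v z
      - a * q z * inner v w + a * q w * inner v z)
    - p z * (q x * \<beta> (L y) w - q y * \<beta> (L x) w) + p w * (q x * \<beta> (L y) z - q y * \<beta> (L x) z)
    + (q z * p w - p z * q w) * ((q x * p y - p x * q y) * inner v v
      + q x * inner v (L y) - q y * inner v (L x))"
proof -
  have v: "p v = 0" "q v = 0" "inner v (e 1) = 0"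
    using n1_coords[OF v_in] by (simp_all add: p_def inner_commute)
  have coords: "p (br x y) = a * (q x * p y - p x * q y)" "q (br x y) = 0"
    unfolding bracket
    by (simp_all add: linear_add[OF linear_p] linear_diff[OF linear_p] linear_cmul[OF linear_p]
        linear_add[OF linear_q] linear_diff[OF linear_q] linear_cmul[OF linear_q]
        basis_coords v L_coords)
  have \<beta>_br: "\<beta> (br x y) w = (q x * p y - p x * q y) * \<beta> v w + q x * \<beta> (L y) w - q y * \<beta> (L x) w" for w
    unfolding bracket by (simp add: \<beta>_linear \<beta>_e1)
  have v_br: "inner v (br x y) = (q x * p y - p x * q y) * inner v v
      + q x * inner v (L y) - q y * inner v (L x)"
    unfolding bracket by (simp add: inner_add_right inner_diff_right v)
  show ?thesis
    unfolding torsion coords \<beta>_br v_br by (simp add: algebra_simps)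
qed

text \<open>
  As \<open>\<beta>\<close> is skew, this is \<open>c \<beta>\<close> plus the derivative \<open>\<beta>(L y, z) + \<beta>(y, L z)\<close> of \<open>\<beta>\<close> along \<open>L\<close>.
\<close>

definition \<tau> :: "real \<Rightarrow> 'a \<Rightarrow> 'a \<Rightarrow> real" where
  "\<tau> c y z = c * \<beta> y z + \<beta> (L y) z - \<beta> (L z) y"

text \<open>
  In invariant form: \<open>dH - \<alpha> \<and> H = e\<^sup>1 \<and> e\<^sup>2\<^sup>n \<and> \<tau>\<close>. The terms with \<open>v\<close> drop out because \<open>\<alpha>\<close>,
  \<open>de\<^sup>1\<close> and the differential of the 1-form dual to \<open>v\<close> only produce wedge products in which \<open>e\<^sup>1\<close>
  or \<open>e\<^sup>2\<^sup>n\<close> is repeated.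
\<close>

lemma d_torsion:
  assumes \<alpha>: "\<And>x. \<alpha> x = l * p x + k * q x"
  shows "d3 br (bismut_torsion br J) x y z w - wedge13 \<alpha> (bismut_torsion br J) x y z w =
    - (q x * p y - p x * q y) * \<tau> (a + k) z w + (q x * p z - p x * q z) * \<tau> (a + k) y w
    - (q x * p w - p x * q w) * \<tau> (a + k) y z - (q y * p z - p y * q z) * \<tau> (a + k) x w
    + (q y * p w - p y * q w) * \<tau> (a + k) x z - (q z * p w - p z * q w) * \<tau> (a + k) x y"
  unfolding d3_def wedge13_def torsion_bracket
  unfolding torsion \<alpha> \<tau>_def
  by (simp add: algebra_simps)

section \<open>The adjoint and the Lyapunov operator\<close>

definition Lt :: "'a \<Rightarrow> 'a" where "Lt = adjoint L"

lemma Lt_works: "inner x (Lt y) = inner (L x) y"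
  unfolding Lt_def by (rule adjoint_works[OF linear_L])

lemma linear_Lt: "linear Lt"
  unfolding Lt_def by (rule adjoint_linear[OF linear_L])

text \<open>
  The first and last coordinates of \<open>Lt x\<close> are inner products of \<open>x\<close> with \<open>L (e 1)\<close> and
  \<open>L (e (2 * n))\<close>, both of which vanish.
\<close>

lemma Lt_in_n1: "Lt x \<in> n1 N J"
proof -
  have "p (Lt x) = 0" "q (Lt x) = 0"
    by (simp_all add: p_def q_def Lt_works L_basis)
  then have "proj (Lt x) = Lt x" by (simp add: proj_def)
  then show ?thesis using proj_in_n1[of "Lt x"] by simp
qed

lemma Lt_basis: "Lt (e 1) = 0" "Lt (e (2 * n)) = 0"
proof -
  have "inner (Lt (e 1)) (Lt (e 1)) = 0" "inner (Lt (e (2 * n))) (Lt (e (2 * n))) = 0"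
    using L_coords[of "Lt (e 1)"] L_coords[of "Lt (e (2 * n))"]
    by (simp_all add: Lt_works p_def q_def inner_commute)
  then show "Lt (e 1) = 0" "Lt (e (2 * n)) = 0" by simp_all
qed

lemma vanishes_iff_on_n1:
  assumes f: "linear f" "f (e 1) = 0" "f (e (2 * n)) = 0"
  shows "(\<forall>x. f x = 0) \<longleftrightarrow> (\<forall>x\<in>n1 N J. f x = 0)"
proof -
  have "f x = f (proj x)" for x
    using f by (subst decompose[of x]) (simp add: linear_add linear_cmul)
  then show ?thesis by (metis proj_in_n1)
qed

text \<open>
  \<open>Lt\<close> satisfies the condition that defines \<open>transpose_on\<close>, and the inner product is
  nondegenerate on \<open>n1 N J\<close>.
\<close>

lemma transpose_on_A:
  assumes "y \<in> n1 N J"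
  shows "transpose_on (n1 N J) A y = Lt y"
proof -
  let ?P = "\<lambda>f'. (\<forall>y\<in>n1 N J. f' y \<in> n1 N J) \<and>
     (\<forall>x\<in>n1 N J. \<forall>y\<in>n1 N J. inner (A x) y = inner x (f' y))"
  have "?P Lt" by (simp add: Lt_in_n1 Lt_works L_n1)
  then have P: "?P (transpose_on (n1 N J) A)"
    unfolding transpose_on_def by (rule someI[where P = ?P])
  let ?d = "transpose_on (n1 N J) A y - Lt y"
  have d: "?d \<in> n1 N J"
    using P assms Lt_in_n1 subspace_n1 by (simp add: subspace_diff)
  have "inner ?d (transpose_on (n1 N J) A y) = inner ?d (Lt y)"
    using P assms d by (simp add: Lt_works L_n1)
  then have "inner ?d ?d = 0" by (simp add: inner_diff_right)
  then show ?thesis by simp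
qed

definition sym_part :: "'a \<Rightarrow> 'a" where "sym_part x = L x + Lt x"

text \<open>
  The operator \<open>L\<^sup>T S + S L + c S\<close> with \<open>S = sym_part\<close>, named after the expression
  \<open>L\<^sup>T X + X L\<close> in the Lyapunov equation of stability theory.
\<close>

definition lyapunov :: "real \<Rightarrow> 'a \<Rightarrow> 'a" where
  "lyapunov c x = Lt (sym_part x) + sym_part (L x) + c *\<^sub>R sym_part x"

lemma linear_sym_part: "linear sym_part"
  unfolding sym_part_def[abs_def] by (intro linear_compose_add linear_L linear_Lt)

lemma linear_lyapunov: "linear (lyapunov c)"
  unfolding lyapunov_def[abs_def]
  using linear_compose[OF linear_sym_part linear_Lt] linear_compose[OF linear_L linear_sym_part]
  by (intro linear_compose_add linear_compose_scale_right linear_sym_part) (simp_all add: o_def)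

lemma sym_part_in_n1: "sym_part x \<in> n1 N J"
  unfolding sym_part_def by (intro subspace_add subspace_n1 L_in_n1 Lt_in_n1)

lemma lyapunov_in_n1: "lyapunov c x \<in> n1 N J"
  unfolding lyapunov_def by (intro subspace_add subspace_scale subspace_n1 sym_part_in_n1 Lt_in_n1)

lemma sym_part_basis: "sym_part (e 1) = 0" "sym_part (e (2 * n)) = 0"
  by (simp_all add: sym_part_def L_basis Lt_basis)

lemma lyapunov_basis: "lyapunov c (e 1) = 0" "lyapunov c (e (2 * n)) = 0"
  by (simp_all add: lyapunov_def L_basis sym_part_basis linear_0[OF linear_Lt] linear_0[OF linear_sym_part])

lemma \<beta>_sym_part: "\<beta> x y = inner (sym_part (J x)) y"
  using Lt_works[of y "J x"] J_skew[of "L y" x]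
  by (simp add: \<beta>_def sym_part_def L_J inner_add_left inner_add_right inner_commute)

text \<open>
  Move \<open>L\<close> across the inner product, and use that \<open>\<beta>\<close> is skew and that \<open>L\<close> commutes with \<open>J\<close>.
\<close>

lemma \<tau>_lyapunov: "\<tau> c y z = inner (lyapunov c (J y)) z"
proof -
  have "\<beta> (L z) y = - inner (Lt (sym_part (J y))) z"
    using \<beta>_skew[of "L z" y] Lt_works[of z "sym_part (J y)"]
    by (simp add: \<beta>_sym_part inner_commute)
  then show ?thesis
    by (simp add: \<tau>_def \<beta>_sym_part lyapunov_def L_J inner_add_left)
qed

text \<open>
  The inner product is nondegenerate and \<open>J\<close> is bijective.
\<close>

lemma \<tau>_vanishes_iff: "(\<forall>y z. \<tau> c y z = 0) \<longleftrightarrow> (\<forall>x\<in>n1 N J. lyapunov c x = 0)"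
proof -
  have "(\<forall>y z. \<tau> c y z = 0) \<longleftrightarrow> (\<forall>y. lyapunov c (J y) = 0)"
    unfolding \<tau>_lyapunov by (metis inner_eq_zero_iff inner_zero_left)
  also have "\<dots> \<longleftrightarrow> (\<forall>x. lyapunov c x = 0)"
    by (metis JJ minus_minus)
  also have "\<dots> \<longleftrightarrow> (\<forall>x\<in>n1 N J. lyapunov c x = 0)"
    by (intro vanishes_iff_on_n1 linear_lyapunov lyapunov_basis)
  finally show ?thesis .
qed

text \<open>
  Evaluating \<open>dH - \<alpha> \<and> H = e\<^sup>1 \<and> e\<^sup>2\<^sup>n \<and> \<tau>\<close> at \<open>e (2 * n), e 1, y, z\<close> recovers \<open>\<tau>\<close> up to sign, as
  \<open>\<tau>\<close> vanishes on \<open>e 1\<close> and on \<open>e (2 * n)\<close>.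
\<close>

lemma d_torsion_eq_wedge_iff:
  assumes \<alpha>: "\<And>x. \<alpha> x = l * p x + k * q x"
  shows "(\<forall>x y z w. d3 br (bismut_torsion br J) x y z w = wedge13 \<alpha> (bismut_torsion br J) x y z w)
    \<longleftrightarrow> (\<forall>x\<in>n1 N J. lyapunov (a + k) x = 0)"
  unfolding \<tau>_vanishes_iff[symmetric]
proof (intro iffI allI)
  fix y z
  assume eq: "\<forall>x y z w. d3 br (bismut_torsion br J) x y z w
    = wedge13 \<alpha> (bismut_torsion br J) x y z w"
  have \<tau>_basis: "\<tau> c (e 1) w = 0" "\<tau> c (e (2 * n)) w = 0" for c w
    using linear_0[OF linear_lyapunov]
    by (simp_all add: \<tau>_lyapunov J_e1 J_e2n lyapunov_basis linear_neg[OF linear_lyapunov])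
  have "\<tau> (a + k) y z = - (d3 br (bismut_torsion br J) (e (2 * n)) (e 1) y z
      - wedge13 \<alpha> (bismut_torsion br J) (e (2 * n)) (e 1) y z)"
    unfolding d_torsion[OF \<alpha>] by (simp add: basis_coords \<tau>_basis)
  then show "\<tau> (a + k) y z = 0" using eq by simp
next
  fix x y z w
  assume "\<forall>y z. \<tau> (a + k) y z = 0"
  then show "d3 br (bismut_torsion br J) x y z w = wedge13 \<alpha> (bismut_torsion br J) x y z w"
    using d_torsion[OF \<alpha>, where x = x and y = y and z = z and w = w] by simp
qed

section \<open>Passage to matrices\<close>

lemma e_in_n1: "i < 2 * n - 2 \<Longrightarrow> e (i + 2) \<in> n1 N J"
  unfolding n1_span by (rule span_base) auto

lemma matrix_carrier: "matrix_n1 n e f \<in> carrier_mat (2 * n - 2) (2 * n - 2)"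
  by (simp add: matrix_n1_def)

lemma matrix_add: "matrix_n1 n e (\<lambda>x. f x + g x) = matrix_n1 n e f + matrix_n1 n e g"
  by (intro eq_matI) (auto simp: matrix_n1_def inner_add_right)

lemma matrix_diff: "matrix_n1 n e (\<lambda>x. f x - g x) = matrix_n1 n e f - matrix_n1 n e g"
  by (intro eq_matI) (auto simp: matrix_n1_def inner_diff_right)

lemma matrix_scale: "matrix_n1 n e (\<lambda>x. c *\<^sub>R f x) = c \<cdot>\<^sub>m matrix_n1 n e f"
  by (intro eq_matI) (auto simp: matrix_n1_def)

lemma matrix_comp:
  assumes f: "linear f" and g: "\<And>x. g x \<in> n1 N J"
  shows "matrix_n1 n e (\<lambda>x. f (g x)) = matrix_n1 n e f * matrix_n1 n e g"
proof (intro eq_matI)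
  fix i j assume "i < dim_row (matrix_n1 n e f * matrix_n1 n e g)"
    "j < dim_col (matrix_n1 n e f * matrix_n1 n e g)"
  then have ij: "i < 2 * n - 2" "j < 2 * n - 2" by (simp_all add: matrix_n1_def)
  have "inner (e (i + 2)) (f (g (e (j + 2))))
      = (\<Sum>k<2*n-2. inner (e (i + 2)) (f (e (k + 2))) * inner (e (k + 2)) (g (e (j + 2))))"
    by (subst n1_expand[OF g])
      (simp add: linear_sum[OF f] linear_cmul[OF f] inner_sum_right mult.commute)
  then show "matrix_n1 n e (\<lambda>x. f (g x)) $$ (i, j) = (matrix_n1 n e f * matrix_n1 n e g) $$ (i, j)"
    using ij by (simp add: matrix_n1_def scalar_prod_def lessThan_atLeast0)
qed (simp_all add: matrix_n1_def)

lemma matrix_eq_0_iff: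
  assumes f: "linear f" "\<And>x. f x \<in> n1 N J"
  shows "matrix_n1 n e f = 0\<^sub>m (2 * n - 2) (2 * n - 2) \<longleftrightarrow> (\<forall>x\<in>n1 N J. f x = 0)"
proof
  assume "matrix_n1 n e f = 0\<^sub>m (2 * n - 2) (2 * n - 2)"
  then have "inner (e (i + 2)) (f (e (j + 2))) = 0" if "i < 2 * n - 2" "j < 2 * n - 2" for i j
    using that by (auto simp: matrix_n1_def mat_eq_iff)
  then have f0: "f (e (j + 2)) = 0" if "j < 2 * n - 2" for j
    using that by (subst n1_expand[OF f(2)]) simp
  show "\<forall>x\<in>n1 N J. f x = 0"
  proof
    fix x assume "x \<in> n1 N J"
    then have "f x = (\<Sum>k<2*n-2. inner (e (k + 2)) x *\<^sub>R f (e (k + 2)))"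
      by (subst n1_expand) (simp_all add: linear_sum[OF f(1)] linear_cmul[OF f(1)])
    then show "f x = 0" by (simp add: f0)
  qed
next
  assume "\<forall>x\<in>n1 N J. f x = 0"
  then show "matrix_n1 n e f = 0\<^sub>m (2 * n - 2) (2 * n - 2)"
    by (intro eq_matI) (auto simp: matrix_n1_def e_in_n1)
qed

lemma matrix_L: "matrix_n1 n e L = matrix_n1 n e A"
  by (intro eq_matI) (auto simp: matrix_n1_def L_n1 e_in_n1)

lemma matrix_Lt: "matrix_n1 n e Lt = transpose_mat (matrix_n1 n e A)"
  by (intro eq_matI)
    (auto simp: matrix_n1_def Lt_works L_n1 e_in_n1 inner_commute)

lemma matrix_sym_part: "matrix_n1 n e sym_part = matrix_n1 n e A + transpose_mat (matrix_n1 n e A)"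
  unfolding sym_part_def[abs_def] matrix_add matrix_L matrix_Lt ..

lemma matrix_lyapunov:
  "matrix_n1 n e (lyapunov c) =
    transpose_mat (matrix_n1 n e A) * (matrix_n1 n e A + transpose_mat (matrix_n1 n e A))
    + (matrix_n1 n e A + transpose_mat (matrix_n1 n e A)) * matrix_n1 n e A
    + c \<cdot>\<^sub>m (matrix_n1 n e A + transpose_mat (matrix_n1 n e A))"
  unfolding lyapunov_def[abs_def]
  by (simp add: matrix_add matrix_scale matrix_comp linear_Lt linear_sym_part sym_part_in_n1 L_in_n1
      matrix_L matrix_Lt matrix_sym_part)

lemma normal_iff_matrix:
  "(\<forall>x\<in>n1 N J. commutator A (transpose_on (n1 N J) A) x = 0) \<longleftrightarrow>
    matrix_n1 n e A * transpose_mat (matrix_n1 n e A)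
    = transpose_mat (matrix_n1 n e A) * matrix_n1 n e A"
proof -
  let ?M = "matrix_n1 n e A" and ?f = "\<lambda>x. L (Lt x) - Lt (L x)"
  have lin: "linear ?f"
    using linear_compose[OF linear_Lt linear_L] linear_compose[OF linear_L linear_Lt]
    by (intro linear_compose_sub) (simp_all add: o_def)
  have in_n1: "?f x \<in> n1 N J" for x
    by (intro subspace_diff subspace_n1 L_in_n1 Lt_in_n1)
  have "commutator A (transpose_on (n1 N J) A) x = ?f x" if "x \<in> n1 N J" for x
    using that by (simp add: commutator_def transpose_on_A L_n1 Lt_in_n1 A_n1)
  then have "(\<forall>x\<in>n1 N J. commutator A (transpose_on (n1 N J) A) x = 0)
      \<longleftrightarrow> matrix_n1 n e ?f = 0\<^sub>m (2 * n - 2) (2 * n - 2)"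
    unfolding matrix_eq_0_iff[OF lin in_n1] by simp
  also have "matrix_n1 n e ?f = ?M * transpose_mat ?M - transpose_mat ?M * ?M"
    by (simp add: matrix_diff matrix_comp linear_L linear_Lt L_in_n1 Lt_in_n1 matrix_L matrix_Lt)
  also have "\<dots> = 0\<^sub>m (2 * n - 2) (2 * n - 2) \<longleftrightarrow> ?M * transpose_mat ?M = transpose_mat ?M * ?M"
    using matrix_carrier[of A] by (auto simp: mat_eq_iff)
  finally show ?thesis .
qed

text \<open>
  Closedness gives \<open>\<alpha>(A x) = \<alpha>([e\<^sub>2\<^sub>n, x]) = 0\<close> on \<open>n1 N J\<close>. So the vector of the values of \<open>\<alpha>\<close> on
  \<open>e 2, \<dots>, e (2 * n - 1)\<close> is in the kernel of the transposed matrix of \<open>A\<close>, which is trivial.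
\<close>

lemma closed_form:
  assumes det: "Determinant.det (matrix_n1 n e A) \<noteq> 0" and closed: "nonzero_closed_form br \<alpha>"
  shows "\<alpha> x = \<alpha> (e 1) * p x + \<alpha> (e (2 * n)) * q x"
proof -
  let ?m = "2 * n - 2" and ?M = "matrix_n1 n e A"
  have lin: "linear \<alpha>" and "\<And>x y. \<alpha> (br x y) = 0"
    using closed by (auto simp: nonzero_closed_form_def d1_def)
  then have \<alpha>A: "\<alpha> (A x) = 0" if "x \<in> n1 N J" for x
    using that by (metis br_n1)
  have \<alpha>_n1: "\<alpha> x = (\<Sum>k<?m. inner (e (k + 2)) x * \<alpha> (e (k + 2)))" if "x \<in> n1 N J" for x
    by (subst n1_expand[OF that]) (simp add: linear_sum[OF lin] linear_cmul[OF lin])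
  define y where "y = Matrix.vec ?m (\<lambda>k. \<alpha> (e (k + 2)))"
  have "transpose_mat ?M *\<^sub>v y = 0\<^sub>v ?m"
  proof (intro eq_vecI)
    fix j assume "j < dim_vec (0\<^sub>v ?m :: real Matrix.vec)"
    then have j: "j < ?m" by simp
    have "vec_index (transpose_mat ?M *\<^sub>v y) j
        = (\<Sum>k<?m. inner (e (k + 2)) (A (e (j + 2))) * \<alpha> (e (k + 2)))"
      using j by (simp add: matrix_n1_def y_def scalar_prod_def lessThan_atLeast0)
    also have "\<dots> = 0"
      using \<alpha>_n1[OF A_n1[OF e_in_n1[OF j]]] \<alpha>A[OF e_in_n1[OF j]] by simp
    finally show "vec_index (transpose_mat ?M *\<^sub>v y) j = vec_index (0\<^sub>v ?m) j"
      using j by simp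
  qed (simp add: matrix_n1_def)
  moreover have "Determinant.det (transpose_mat ?M) \<noteq> 0"
    using det det_transpose[OF matrix_carrier[of A]] by simp
  moreover have "y \<in> carrier_vec ?m" by (simp add: y_def)
  ultimately have "y = 0\<^sub>v ?m"
    using det_0_iff_vec_prod_zero[of "transpose_mat ?M" ?m] matrix_carrier[of A]
    by auto
  then have "\<alpha> (e (k + 2)) = 0" if "k < ?m" for k
    using that by (metis index_vec index_zero_vec(1) y_def)
  then have "\<alpha> (proj x) = 0" by (simp add: \<alpha>_n1[OF proj_in_n1])
  then show ?thesis
    by (subst decompose[of x]) (simp add: linear_add[OF lin] linear_cmul[OF lin])
qed

end

section \<open>The characterisation\<close>

theorem theorem4p3:
  fixes br :: "'a::euclidean_space \<Rightarrow> 'a \<Rightarrow> 'a" and J A :: "'a \<Rightarrow> 'a"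
    and N :: "'a set" and n :: nat and e :: "nat \<Rightarrow> 'a"
    and a :: real and v :: 'a and \<alpha> :: "'a \<Rightarrow> real"
  assumes "hermitian_almost_abelian br J N n e a v A"
    and "Determinant.det (matrix_n1 n e A) \<noteq> 0"
    and "nonzero_closed_form br \<alpha>"
  shows "lcskt_with br J \<alpha> \<longleftrightarrow>
    (\<forall>x\<in>n1 N J. commutator A (transpose_on (n1 N J) A) x = 0) \<and>
    (\<forall>x\<in>n1 N J. commutator A J x = 0) \<and>
    (\<forall>\<mu>::complex. eigenvalue (map_mat complex_of_real (matrix_n1 n e A)) \<mu> \<longrightarrow>
       Re \<mu> = 0 \<or> Re \<mu> = - (1/2) * (a + \<alpha> (e (2*n))))"
proof -
  interpret hermitian_almost_abelian_algebra br J A N n e a v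
    by unfold_locales (rule assms(1))
  let ?V = "n1 N J" and ?M = "matrix_n1 n e A" and ?c = "a + \<alpha> (e (2 * n))"
  have "lcskt_with br J \<alpha> \<longleftrightarrow> (\<forall>x\<in>?V. lyapunov ?c x = 0)"
    using assms(3) d_torsion_eq_wedge_iff[OF closed_form[OF assms(2,3)]]
    by (simp add: lcskt_with_def)
  also have "\<dots> \<longleftrightarrow> matrix_n1 n e (lyapunov ?c) = 0\<^sub>m (2 * n - 2) (2 * n - 2)"
    by (rule matrix_eq_0_iff[OF linear_lyapunov lyapunov_in_n1, symmetric])
  also have "\<dots> \<longleftrightarrow> ?M * transpose_mat ?M = transpose_mat ?M * ?M \<and>
      (\<forall>\<mu>. eigenvalue (map_mat complex_of_real ?M) \<mu> \<longrightarrow> Re \<mu> = 0 \<or> Re \<mu> = - (1/2) * ?c)"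
    unfolding matrix_lyapunov by (rule lyapunov_iff_normal_eigenvalues_real[OF matrix_carrier])
  finally have main: "lcskt_with br J \<alpha> \<longleftrightarrow> \<dots>" .
  have "\<forall>x\<in>?V. commutator A J x = 0"
    by (simp add: commutator_def comm_AJ)
  with main show ?thesis
    unfolding normal_iff_matrix by blast
qed

end
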